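(* Let $A$ be a finite or countably infinite set, let $P_a=(p_{a,k})_{k\ge1}$, $a\in A$, be probability distributions on $\mathbb N_+$, and let $Z=(Z_n)_{n\ge1}=((X_n,K_n))_{n\ge1}$ be the regime switching process on $A\times\mathbb N_+$ with these letter distributions and with an arbitrary underlying $A$-valued process $X$. Assume that for some $\alpha\in[0,1]$ and some non-increasing slowly varying function $\ell$ we have $$\nu(a,\epsilon)\le\epsilon^{-\alpha}\ell(1/\epsilon)\qquad\text{for all }a\in A\text{ and all }\epsilon\in(0,1].$$ Then for all integers $n\ge1$ and $r\ge0$, $$\mathbf P\{\mathcal L_n=r\}\le c_1(\alpha,r)\,\mathbf E\left[\mathbf 1\{L_n>r\}L_n^{-(1-\alpha)}\ell(L_n)\right]+c_2(\alpha,r)\,\mathbf P\{L_n=r\},$$ where $$c_1(\alpha,r)=c(r)+\frac{4^{1+r}}{r!}(1+r)^{1+r-\alpha}\,\gamma\left(1+r-\alpha,\tfrac12\right),$$ $$c_2(\alpha,r)=\begin{cases}1&r=0,\\ \min\left\{1,\;p_\vee^{r+1}r^\alpha\ell(r)+r^{-r}\right\}&r\ge1,\end{cases}$$ with $p_\vee=\sup\{p_{a,k}:(a,k)\in A\times\mathbb N_+\}$, $\gamma(t,x)=\int_0^xu^{t-1}e^{-u}\,du$ the incomplete gamma function, $c(0)=e^{-1}$ and $c(r)=e(1+r)/\sqrt\pi$ for $r\ge1$ (here $\pi=3.14159\ldots$).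
   Context: $\mathbb N_+=\{1,2,\dots\}$. Regime switching process: let $R=\{R_n\}_{n\ge1}$ be the family of conditional distributions of an arbitrary discrete time process on $A$, i.e. $R_1$ is a distribution on $A$ and $R_n(\cdot\mid a_1,\dots,a_{n-1})$, $n\ge2$, is the conditional distribution of the $n$-th value given the first $n-1$ values. $Z$ is the process on $A\times\mathbb N_+$ with $\mathbf P\{Z_1=(a,k)\}=R_1(a)p_{a,k}$ and, for $n\ge2$, $\mathbf P\{Z_n=(a_n,k_n)\mid Z_1=(a_1,k_1),\dots,Z_{n-1}=(a_{n-1},k_{n-1})\}=R_n(a_n\mid a_1,\dots,a_{n-1})\,p_{a_n,k_n}$. Write $Z_n=(X_n,K_n)$; $X$ is called the underlying process. Set $$\mathcal L_n=\sum_{i=1}^n\mathbf 1\{Z_i=Z_{n+1}\},\qquad L_n=\sum_{i=1}^n\mathbf 1\{X_i=X_{n+1}\}.$$ The counting function of $P_a$ is $\nu(a,\epsilon)=\sum_{k\ge1}\mathbf 1\{p_{a,k}\ge\epsilon\}$. A function $\ell:(0,\infty)\to\mathbb R$ is slowly varying (at $+\infty$) if $\lim_{x\to\infty}\ell(cx)/\ell(x)=1$ for every $c>0$. When $\alpha=1$ and $r=0$, $\gamma(0,1/2)=+\infty$, so $c_1=+\infty$ and the bound is trivial (with $\infty\cdot0=0$). *)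

theory Defs
  imports "HOL-Probability.Probability"
begin

text \<open>
  Times are the positive integers: \<open>Z 0\<close> is a junk value that is never used.
  The kernels \<open>R\<^sub>n\<close> are bundled into one function of the history: \<open>R [a\<^sub>1, \<dots>, a\<^sub>n\<^sub>-\<^sub>1]\<close> is
  \<open>R\<^sub>n(\<cdot> | a\<^sub>1, \<dots>, a\<^sub>n\<^sub>-\<^sub>1)\<close>, and \<open>R []\<close> is \<open>R\<^sub>1\<close>. Values of \<open>P\<close> outside \<open>A\<close> and of \<open>R\<close>
  outside \<open>lists A\<close> are irrelevant. Conditional probabilities are prescribed only where the
  conditioning event has positive probability.
\<close>

locale regime_switching_process = prob_space M
  for M :: "'w measure"
    and A :: "'a set"
    and P :: "'a \<Rightarrow> nat pmf"
    and R :: "'a list \<Rightarrow> 'a pmf"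
    and Z :: "nat \<Rightarrow> 'w \<Rightarrow> 'a \<times> nat" +
  assumes countable_alphabet: "countable A"
    and letter_distributions: "\<And>a. a \<in> A \<Longrightarrow> set_pmf (P a) \<subseteq> {1..}"
    and kernels: "\<And>as. as \<in> lists A \<Longrightarrow> set_pmf (R as) \<subseteq> A"
    and random_variables: "\<And>n. 1 \<le> n \<Longrightarrow> Z n \<in> measurable M (count_space (A \<times> {1..}))"
    and initial_law:
      "\<And>a k. a \<in> A \<Longrightarrow> 1 \<le> k \<Longrightarrow>
        \<P>(\<omega> in M. Z 1 \<omega> = (a, k)) = pmf (R []) a * pmf (P a) k"
    and conditional_law:
      "\<And>n a k. 2 \<le> n \<Longrightarrow>
        (\<And>i. i \<in> {1..n} \<Longrightarrow> a i \<in> A \<and> 1 \<le> k i) \<Longrightarrow>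
        \<P>(\<omega> in M. \<forall>i\<in>{1..<n}. Z i \<omega> = (a i, k i)) > 0 \<Longrightarrow>
        \<P>(\<omega> in M. Z n \<omega> = (a n, k n) \<bar> \<forall>i\<in>{1..<n}. Z i \<omega> = (a i, k i)) =
          pmf (R (map a [1..<n])) (a n) * pmf (P (a n)) (k n)"

definition underlying :: "(nat \<Rightarrow> 'w \<Rightarrow> 'a \<times> nat) \<Rightarrow> nat \<Rightarrow> 'w \<Rightarrow> 'a" where
  "underlying Z n \<omega> = fst (Z n \<omega>)"

text \<open>\<open>\<L>\<^sub>n\<close> is \<open>repeats Z n\<close> and \<open>L\<^sub>n\<close> is \<open>repeats (underlying Z) n\<close>.\<close>

definition repeats :: "(nat \<Rightarrow> 'w \<Rightarrow> 'b) \<Rightarrow> nat \<Rightarrow> 'w \<Rightarrow> nat" where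
  "repeats Y n \<omega> = (\<Sum>i=1..n. of_bool (Y i \<omega> = Y (n + 1) \<omega>))"

text \<open>For \<open>\<epsilon> > 0\<close> only finitely many terms are nonzero, so the real-valued sum is not a junk value.\<close>

definition counting_function :: "('a \<Rightarrow> nat pmf) \<Rightarrow> 'a \<Rightarrow> real \<Rightarrow> real" where
  "counting_function P a \<epsilon> = (\<Sum>\<^sub>\<infinity>k\<in>{1..}. of_bool (pmf (P a) k \<ge> \<epsilon>))"

definition slowly_varying :: "(real \<Rightarrow> real) \<Rightarrow> bool" where
  "slowly_varying l \<longleftrightarrow> (\<forall>c>0. ((\<lambda>x. l (c * x) / l x) \<longlongrightarrow> 1) at_top)"

text \<open>
  The integral is taken in \<open>[0, \<infinity>]\<close>, so that \<open>\<gamma>(0, 1/2) = \<infinity>\<close>; the integrand is set to \<open>0\<close> at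
  the single point \<open>u = 0\<close>.
\<close>

definition inc_gamma :: "real \<Rightarrow> real \<Rightarrow> ereal" where
  "inc_gamma t x = enn2ereal (\<integral>\<^sup>+u\<in>{0<..x}. ennreal (u powr (t - 1) * exp (- u)) \<partial>lborel)"

definition c_const :: "nat \<Rightarrow> real" where
  "c_const r = (if r = 0 then exp (- 1) else exp 1 * (1 + real r) / sqrt pi)"

definition c1 :: "real \<Rightarrow> nat \<Rightarrow> ereal" where
  "c1 \<alpha> r = ereal (c_const r)
     + ereal (4 ^ (1 + r) / fact r * (1 + real r) powr (1 + real r - \<alpha>))
       * inc_gamma (1 + real r - \<alpha>) (1 / 2)"

definition p_sup :: "'a set \<Rightarrow> ('a \<Rightarrow> nat pmf) \<Rightarrow> real" where
  "p_sup A P = (SUP (a, k)\<in>A \<times> {1..}. pmf (P a) k)"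

definition c2 :: "'a set \<Rightarrow> ('a \<Rightarrow> nat pmf) \<Rightarrow> (real \<Rightarrow> real) \<Rightarrow> real \<Rightarrow> nat \<Rightarrow> real" where
  "c2 A P l \<alpha> r =
     (if r = 0 then 1
      else min 1 (p_sup A P ^ (r + 1) * real r powr \<alpha> * l (real r) + real r powr (- real r)))"

end

theory Submission
  imports Defs
begin

text \<open>
  Conditionally on the underlying process, \<open>K\<^sub>1, K\<^sub>2, \<dots>\<close> are independent with
  \<open>K\<^sub>i \<sim> P\<^bsub>X\<^sub>i\<^esub>\<close>, so on \<open>L\<^sub>n = m\<close>, \<open>X\<^sub>n\<^sub>+\<^sub>1 = a\<close> the probability of
  \<open>\<L>\<^sub>n = r\<close> is the binomial mixture \<open>\<Sum>\<^sub>k p\<^sub>k (m choose r) p\<^sub>k\<^sup>r (1 - p\<^sub>k)\<^sup>m\<^sup>-\<^sup>r\<close>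
  with \<open>p\<^sub>k = p\<^bsub>a,k\<^esub>\<close>. For \<open>m > r\<close> split it at \<open>p\<^sub>k = 1/m\<close>. There are at most
  \<open>\<nu>(a, 1/m) \<le> m\<^sup>\<alpha> \<ell>(m)\<close> large terms, each at most \<open>c(r)/m\<close>. The small ones are bounded by
  \<open>(m\<^sup>r/r!) \<Sum>\<^sub>k p\<^sub>k\<^sup>r\<^sup>+\<^sup>1\<close>, which the layer cake formula turns into an integral of
  \<open>\<nu>(a, x) \<le> x\<^sup>-\<^sup>\<alpha> \<ell>(m)\<close> over \<open>x \<le> 1/m\<close>; this uses the monotonicity of \<open>\<ell>\<close>. For
  \<open>m = r\<close> the mixture is \<open>\<Sum>\<^sub>k p\<^sub>k\<^sup>r\<^sup>+\<^sup>1\<close>, split at \<open>1/r\<close>.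
\<close>

subsection \<open>Numbers of repetitions\<close>

lemma repeats_cong:
  "(\<And>i. i \<in> {1..Suc n} \<Longrightarrow> Y i \<omega> = Y' i \<omega>') \<Longrightarrow> repeats Y n \<omega> = repeats Y' n \<omega>'"
  unfolding repeats_def by (intro sum.cong) auto

lemma repeats_eq_card: "repeats Y n \<omega> = card {i \<in> {1..n}. Y i \<omega> = Y (Suc n) \<omega>}"
  by (simp add: repeats_def Int_def)

lemma repeats_le: "repeats Y n \<omega> \<le> n"
proof -
  have "card {i \<in> {1..n}. Y i \<omega> = Y (Suc n) \<omega>} \<le> card {1..n}"
    by (rule card_mono) auto
  then show ?thesis
    unfolding repeats_eq_card by simp
qed

lemma repeats_le_repeats_underlying: "repeats Z n \<omega> \<le> repeats (underlying Z) n \<omega>"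
  unfolding repeats_eq_card by (intro card_mono) (auto simp: underlying_def)

subsection \<open>Matches among independent letters\<close>

text \<open>The indicators of \<open>f i = y\<close> are independent Bernoulli variables with
  parameter \<open>pmf q y\<close>, and a binomial variable counts the successes among such
  indicators.\<close>

lemma counting_matches_Pi_pmf:
  assumes "finite I"
  shows "map_pmf (\<lambda>f. card {i \<in> I. f i = y}) (Pi_pmf I d (\<lambda>_. q)) = binomial_pmf (card I) (pmf q y)"
proof -
  have b: "map_pmf (\<lambda>x. x = y) q = bernoulli_pmf (pmf q y)"
  proof (rule pmf_eqI)
    fix b
    have "pmf (map_pmf (\<lambda>x. x = y) q) True = pmf q y"
      by (simp add: pmf_map vimage_def measure_pmf_single)
    moreover have "pmf (map_pmf (\<lambda>x. x = y) q) False = 1 - pmf q y"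
      using measure_pmf.prob_compl[of "{y}" q]
      by (simp add: pmf_map vimage_def measure_pmf_single Compl_eq_Diff_UNIV[symmetric] Collect_neg_eq)
    ultimately show "pmf (map_pmf (\<lambda>x. x = y) q) b = pmf (bernoulli_pmf (pmf q y)) b"
      by (cases b) (simp_all add: pmf_le_1)
  qed
  have "binomial_pmf (card I) (pmf q y) =
      map_pmf (\<lambda>f. card {x\<in>I. f x}) (Pi_pmf I (d = y) (\<lambda>_. bernoulli_pmf (pmf q y)))"
    by (rule binomial_pmf_altdef') (use assms in \<open>auto simp: pmf_le_1\<close>)
  also have "Pi_pmf I (d = y) (\<lambda>_. bernoulli_pmf (pmf q y)) = map_pmf ((\<circ>) (\<lambda>x. x = y)) (Pi_pmf I d (\<lambda>_. q))"
    unfolding b[symmetric] by (rule Pi_pmf_map) (use assms in auto)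
  finally show ?thesis
    by (simp add: pmf.map_comp o_def)
qed

text \<open>Draw the coordinate \<open>Suc n\<close> first. Since \<open>I\<close> does not contain
  it, its value \<open>y\<close> leaves the coordinates in \<open>I\<close> untouched; these are
  independent with the same law \<open>q (Suc n)\<close>, so their matches with \<open>y\<close> are
  binomial. Averaging over \<open>y\<close> gives the mixture.\<close>

lemma emeasure_Pi_pmf_matches:
  fixes q :: "nat \<Rightarrow> 'b pmf"
  assumes I: "I \<subseteq> {1..n}" and q: "\<And>i. i \<in> I \<Longrightarrow> q i = q (Suc n)"
  shows "emeasure (Pi_pmf {1..Suc n} d q) {k. card {i \<in> I. k i = k (Suc n)} = r} =
    (\<integral>\<^sup>+y. pmf (binomial_pmf (card I) (pmf (q (Suc n)) y)) r \<partial>q (Suc n))"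
proof -
  have ins: "{1..Suc n} = insert (Suc n) {1..n}"
    by auto
  have fI: "finite I" using I finite_subset by blast
  have eq: "{i \<in> I. (k(Suc n := y)) i = (k(Suc n := y)) (Suc n)} = {i \<in> I. k i = y}" for k :: "nat \<Rightarrow> 'b" and y
    using I by auto
  have cong: "Pi_pmf I d q = Pi_pmf I d (\<lambda>_. q (Suc n))"
    by (rule Pi_pmf_cong) (use q in auto)
  have sub: "map_pmf (\<lambda>k. card {i \<in> I. k i = y}) (Pi_pmf {1..n} d q) =
      binomial_pmf (card I) (pmf (q (Suc n)) y)" for y
    unfolding counting_matches_Pi_pmf[OF fI, of y d, symmetric] cong[symmetric]
    by (subst Pi_pmf_subset[of "{1..n}" I]) (use I in \<open>auto simp: pmf.map_comp o_def cong: conj_cong\<close>)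
  have "emeasure (Pi_pmf (insert (Suc n) {1..n}) d q) {k. card {i \<in> I. k i = k (Suc n)} = r} =
     emeasure (map_pmf (\<lambda>k. card {i \<in> I. k i = k (Suc n)}) (Pi_pmf (insert (Suc n) {1..n}) d q)) {r}"
    by (simp add: vimage_def)
  also have "map_pmf (\<lambda>k. card {i \<in> I. k i = k (Suc n)}) (Pi_pmf (insert (Suc n) {1..n}) d q) =
     bind_pmf (q (Suc n)) (\<lambda>y. binomial_pmf (card I) (pmf (q (Suc n)) y))"
    unfolding sub[symmetric]
    by (subst Pi_pmf_insert') (auto simp: map_bind_pmf eq map_pmf_def bind_assoc_pmf bind_return_pmf simp del: fun_upd_apply intro!: bind_pmf_cong)
  also have "emeasure \<dots> {r} = (\<integral>\<^sup>+y. pmf (binomial_pmf (card I) (pmf (q (Suc n)) y)) r \<partial>q (Suc n))"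
    by (simp only: emeasure_pmf_single ennreal_pmf_bind)
  finally show ?thesis
    unfolding ins .
qed

subsection \<open>The regime switching process\<close>

context regime_switching_process begin

section \<open>Measurability of events determined by finitely many values\<close>

lemma value_in: "1 \<le> i \<Longrightarrow> \<omega> \<in> space M \<Longrightarrow> Z i \<omega> \<in> A \<times> {1..}"
  using measurable_space[OF random_variables] by auto

lemma countable_values: "countable (A \<times> {1::nat..})"
  using countable_alphabet by auto

lemma value_event: "1 \<le> i \<Longrightarrow> {\<omega>\<in>space M. Z i \<omega> = c} \<in> events"
proof -
  assume i: "1 \<le> i"
  have "{\<omega>\<in>space M. Z i \<omega> = c} = Z i -` ({c} \<inter> (A \<times> {1..})) \<inter> space M"
    using value_in[OF i] by auto
  also have "\<dots> \<in> events"
    by (rule measurable_sets[OF random_variables[OF i]]) auto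
  finally show ?thesis .
qed

lemma history_event: "{\<omega>\<in>space M. \<forall>i\<in>{1..N}. Z i \<omega> = z i} \<in> events"
  by (rule sets.sets_Collect_finite_All) (auto intro: value_event)

text \<open>Histories of length \<open>N\<close> range over a countable set, so every predicate
  \<open>Q\<close>, with no measurability condition, holds on a countable union of elementary
  history events. Restricting to \<open>{1..N}\<close> makes the history a unique extensional
  function.\<close>

lemma history_pred: "{\<omega>\<in>space M. Q (restrict (\<lambda>i. Z i \<omega>) {1..N})} \<in> events"
proof -
  let ?H = "PiE {1..N} (\<lambda>_. A \<times> {1::nat..})"
  have "{\<omega>\<in>space M. Q (restrict (\<lambda>i. Z i \<omega>) {1..N})} =
     {\<omega>\<in>space M. \<exists>h\<in>{h\<in>?H. Q h}. \<forall>i\<in>{1..N}. Z i \<omega> = h i}"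
  proof (intro Collect_cong conj_cong refl)
    fix \<omega> assume \<omega>: "\<omega> \<in> space M"
    let ?h = "restrict (\<lambda>i. Z i \<omega>) {1..N}"
    have in_H: "?h \<in> ?H"
      using value_in[OF _ \<omega>] by (intro restrict_PiE_iff[THEN iffD2] ballI) simp
    have "h = ?h" if "h \<in> ?H" "\<forall>i\<in>{1..N}. Z i \<omega> = h i" for h
      by (rule PiE_ext[OF that(1) in_H]) (use that(2) in simp)
    moreover have "\<forall>i\<in>{1..N}. Z i \<omega> = ?h i"
      by simp
    ultimately show "Q ?h \<longleftrightarrow> (\<exists>h\<in>{h\<in>?H. Q h}. \<forall>i\<in>{1..N}. Z i \<omega> = h i)"
      using in_H by blast
  qed
  also have "\<dots> \<in> events"
  proof (rule sets.sets_Collect_countable_Ex'[OF history_event])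
    show "countable {h\<in>?H. Q h}"
    proof (rule countable_subset)
      show "{h\<in>?H. Q h} \<subseteq> ?H"
        by blast
      show "countable ?H"
        by (intro countable_PiE countable_values) simp
    qed
  qed
  finally show ?thesis .
qed

lemma repeats_event: "{\<omega>\<in>space M. Q (repeats Z n \<omega>) (repeats (underlying Z) n \<omega>)} \<in> events"
proof -
  have "repeats Z n \<omega> = repeats (\<lambda>i h. h i) n (restrict (\<lambda>i. Z i \<omega>) {1..Suc n})" for \<omega>
    by (rule repeats_cong) auto
  moreover have "repeats (underlying Z) n \<omega> =
      repeats (\<lambda>i h. fst (h i)) n (restrict (\<lambda>i. Z i \<omega>) {1..Suc n})" for \<omega>
    by (rule repeats_cong) (auto simp: underlying_def)
  ultimately show ?thesis
    using history_pred[of "\<lambda>h. Q (repeats (\<lambda>i h. h i) n h) (repeats (\<lambda>i h. fst (h i)) n h)" "Suc n"]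
    by simp
qed

section \<open>Joint law of the process and law of the regimes along a fixed underlying path\<close>

text \<open>Multiplying the conditional laws separates two products: the weight of the underlying
  path and the letter probabilities along it. The second product is the source of the conditional
  independence of the regimes.\<close>

lemma joint_law:
  assumes "\<And>i. i \<in> {1..N} \<Longrightarrow> a i \<in> A \<and> 1 \<le> k i"
  shows "\<P>(\<omega> in M. \<forall>i\<in>{1..N}. Z i \<omega> = (a i, k i)) =
    (\<Prod>i=1..N. pmf (R (map a [1..<i])) (a i)) * (\<Prod>i=1..N. pmf (P (a i)) (k i))"
  using assms
proof (induction N)
  case 0
  then show ?case by (simp add: prob_space)
next
  case (Suc N)
  let ?past = "\<lambda>\<omega>. \<forall>i\<in>{1..N}. Z i \<omega> = (a i, k i)"
  let ?f = "pmf (R (map a [1..<Suc N])) (a (Suc N)) * pmf (P (a (Suc N))) (k (Suc N))"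
  have IH: "\<P>(\<omega> in M. ?past \<omega>) =
    (\<Prod>i=1..N. pmf (R (map a [1..<i])) (a i)) * (\<Prod>i=1..N. pmf (P (a i)) (k i))"
    using Suc by auto
  have split: "(\<forall>i\<in>{1..Suc N}. Z i \<omega> = (a i, k i)) \<longleftrightarrow> Z (Suc N) \<omega> = (a (Suc N), k (Suc N)) \<and> ?past \<omega>" for \<omega>
    by (simp add: atLeastAtMostSuc_conv)
  have "\<P>(\<omega> in M. \<forall>i\<in>{1..Suc N}. Z i \<omega> = (a i, k i)) = \<P>(\<omega> in M. ?past \<omega>) * ?f"
  \<comment> \<open>The conditional law is prescribed from the second time on, so the first factor
    has to come from \<open>initial_law\<close>.\<close>
  proof (cases "N = 0")
    case True
    then show ?thesis
      using initial_law[of "a 1" "k 1"] Suc.prems[of 1] by (simp add: prob_space)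
  next
    case False
    show ?thesis
    proof (cases "\<P>(\<omega> in M. ?past \<omega>) > 0")
      case True
      have "\<P>(\<omega> in M. Z (Suc N) \<omega> = (a (Suc N), k (Suc N)) \<bar> ?past \<omega>) = ?f"
        using conditional_law[of "Suc N" a k] True False Suc.prems
        unfolding atLeastLessThanSuc_atLeastAtMost by auto
      then show ?thesis
        using True unfolding split cond_prob_def by (simp add: field_simps)
    next
      \<comment> \<open>Nothing is prescribed after a null past, but then both sides are 0.\<close>
      case False
      then have "\<P>(\<omega> in M. ?past \<omega>) = 0"
        by (simp add: zero_less_measure_iff)
      moreover have "\<P>(\<omega> in M. \<forall>i\<in>{1..Suc N}. Z i \<omega> = (a i, k i)) \<le> \<P>(\<omega> in M. ?past \<omega>)"
        by (intro finite_measure_mono history_event) auto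
      ultimately show ?thesis
        by (simp add: measure_le_0_iff)
    qed
  qed
  then show ?case
    unfolding IH by (simp add: algebra_simps)
qed

text \<open>Summing \<open>joint_law\<close> over the regime sequences in \<open>S\<close> shows
  that along the path \<open>a\<close> the regimes are independent with laws \<open>P (a i)\<close>.
  The product form needs no division by the weight of the path, which may be 0. The value 0 outside
  \<open>{1..N}\<close> matches the default of \<open>Pi_pmf\<close>.\<close>

lemma conditional_regimes:
  assumes a: "\<And>i. i \<in> {1..N} \<Longrightarrow> a i \<in> A"
  shows "ennreal (\<P>(\<omega> in M. (\<forall>i\<in>{1..N}. underlying Z i \<omega> = a i) \<and>
            (\<lambda>i. if i \<in> {1..N} then snd (Z i \<omega>) else 0) \<in> S)) =
    ennreal (\<Prod>i=1..N. pmf (R (map a [1..<i])) (a i)) * emeasure (Pi_pmf {1..N} 0 (\<lambda>i. P (a i))) S"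
proof -
  let ?w = "\<Prod>i=1..N. pmf (R (map a [1..<i])) (a i)"
  let ?Q = "Pi_pmf {1..N} 0 (\<lambda>i. P (a i))"
  \<comment> \<open>\<open>joint_law\<close> covers only regimes that are at least 1, so the sum
    runs over the countable set \<open>?D\<close> of such sequences.\<close>
  let ?D = "PiE_dflt {1..N} 0 (\<lambda>_. {1::nat..})"
  have cD: "countable ?D"
    unfolding dflt_image_PiE[symmetric] by (intro countable_image countable_PiE) auto
  have "\<P>(\<omega> in M. (\<forall>i\<in>{1..N}. underlying Z i \<omega> = a i) \<and>
            (\<lambda>i. if i \<in> {1..N} then snd (Z i \<omega>) else 0) \<in> S) =
     \<P>(\<omega> in M. \<exists>k\<in>?D \<inter> S. \<forall>i\<in>{1..N}. Z i \<omega> = (a i, k i))"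
  proof (intro arg_cong[of _ _ prob] Collect_cong conj_cong refl)
    fix \<omega> assume \<omega>: "\<omega> \<in> space M"
    let ?k = "\<lambda>i. if i \<in> {1..N} then snd (Z i \<omega>) else 0"
    have in_D: "?k \<in> ?D"
      using value_in[OF _ \<omega>] by (force simp: PiE_dflt_def mem_Times_iff)
    have "k = ?k" if "k \<in> ?D" "\<forall>i\<in>{1..N}. Z i \<omega> = (a i, k i)" for k
      using that by (auto simp: PiE_dflt_def fun_eq_iff)
    moreover have "(\<forall>i\<in>{1..N}. Z i \<omega> = (a i, ?k i)) \<longleftrightarrow> (\<forall>i\<in>{1..N}. underlying Z i \<omega> = a i)"
      by (auto simp: underlying_def prod_eq_iff)
    moreover have "\<forall>i\<in>{1..N}. underlying Z i \<omega> = a i" if "\<forall>i\<in>{1..N}. Z i \<omega> = (a i, k i)" for k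
      using that by (auto simp: underlying_def)
    ultimately show "((\<forall>i\<in>{1..N}. underlying Z i \<omega> = a i) \<and> ?k \<in> S) \<longleftrightarrow>
        (\<exists>k\<in>?D \<inter> S. \<forall>i\<in>{1..N}. Z i \<omega> = (a i, k i))"
      using in_D by (metis (no_types, lifting) IntE IntI)
  qed
  also have "ennreal \<dots> = (\<integral>\<^sup>+k. \<P>(\<omega> in M. \<forall>i\<in>{1..N}. Z i \<omega> = (a i, k i)) \<partial>count_space (?D \<inter> S))"
  proof (rule prob_EX_countable)
    show "countable (?D \<inter> S)" using cD by auto
    show "AE \<omega> in M. \<forall>k\<in>?D \<inter> S. \<forall>k'\<in>?D \<inter> S.
        (\<forall>i\<in>{1..N}. Z i \<omega> = (a i, k i)) \<longrightarrow> (\<forall>i\<in>{1..N}. Z i \<omega> = (a i, k' i)) \<longrightarrow> k = k'"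
    proof (intro AE_I2 ballI impI)
      fix \<omega> k k' assume "k \<in> ?D \<inter> S" "k' \<in> ?D \<inter> S"
        and "\<forall>i\<in>{1..N}. Z i \<omega> = (a i, k i)" "\<forall>i\<in>{1..N}. Z i \<omega> = (a i, k' i)"
      then have "k i = k' i" for i
        by (cases "i \<in> {1..N}") (auto simp: PiE_dflt_def)
      then show "k = k'" ..
    qed
  qed (rule history_event)
  also have "\<dots> = (\<integral>\<^sup>+k. ennreal ?w * ennreal (pmf ?Q k) \<partial>count_space (?D \<inter> S))"
  proof (rule nn_integral_cong, goal_cases)
    case (1 k)
    then have k: "k \<in> ?D" by auto
    then have "pmf ?Q k = (\<Prod>i=1..N. pmf (P (a i)) (k i))"
      by (intro pmf_Pi') (auto simp: PiE_dflt_def)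
    then show ?case
      using k a by (subst joint_law)
        (auto simp: PiE_dflt_def ennreal_mult[symmetric] prod_nonneg)
  qed
  also have "\<dots> = ennreal ?w * emeasure ?Q (?D \<inter> S)"
    by (simp add: nn_integral_cmult nn_integral_pmf)
  \<comment> \<open>The letter distributions live on the positive integers, so \<open>?Q\<close>
    puts all its mass on \<open>?D\<close>.\<close>
  also have "emeasure ?Q (?D \<inter> S) = emeasure ?Q S"
  proof (rule emeasure_eq_AE)
    have "set_pmf ?Q \<subseteq> ?D"
      using letter_distributions a
      by (subst set_Pi_pmf) (fastforce simp: PiE_dflt_def)+
    then show "AE k in ?Q. k \<in> ?D \<inter> S \<longleftrightarrow> k \<in> S"
      by (auto simp: AE_measure_pmf_iff)
  qed auto
  finally show ?thesis .
qed

text \<open>For each underlying path \<open>a\<close> with \<open>m\<close> repetitions, the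
  conditional probability of \<open>r\<close> repetitions of the pairs is the mixture for the last
  letter \<open>a (Suc n)\<close>. A bound \<open>B\<close> that is uniform in the letter therefore
  survives the summation over paths.\<close>

lemma repeats_bound:
  assumes "0 \<le> B"
    and B: "\<And>x. x \<in> A \<Longrightarrow> (\<integral>\<^sup>+y. pmf (binomial_pmf m (pmf (P x) y)) r \<partial>P x) \<le> ennreal B"
  shows "\<P>(\<omega> in M. repeats Z n \<omega> = r \<and> repeats (underlying Z) n \<omega> = m) \<le>
    B * \<P>(\<omega> in M. repeats (underlying Z) n \<omega> = m)"
proof -
  let ?I = "\<lambda>a :: nat \<Rightarrow> 'a. {i \<in> {1..n}. a i = a (Suc n)}"
  let ?A = "PiE {1..Suc n} (\<lambda>_. A)"
  let ?H = "{a \<in> ?A. card (?I a) = m}"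
  let ?X = "\<lambda>a \<omega>. \<forall>i\<in>{1..Suc n}. underlying Z i \<omega> = a i"
  let ?K = "\<lambda>\<omega> i. if i \<in> {1..Suc n} then snd (Z i \<omega>) else 0"
  let ?S = "\<lambda>a. {k. card {i \<in> ?I a. k i = k (Suc n)} = r}"
  let ?w = "\<lambda>a. ennreal (\<Prod>i=1..Suc n. pmf (R (map a [1..<i])) (a i))"
  have event: "{\<omega>\<in>space M. ?X a \<omega> \<and> ?K \<omega> \<in> S} \<in> events" for a S
    using history_pred[of "\<lambda>h. (\<forall>i\<in>{1..Suc n}. fst (h i) = a i) \<and>
      (\<lambda>i. if i \<in> {1..Suc n} then snd (h i) else 0) \<in> S" "Suc n"]
    by (simp add: underlying_def cong: if_cong)
  have countable: "countable ?H"
  proof (rule countable_subset)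
    show "?H \<subseteq> ?A"
      by blast
    show "countable ?A"
      by (intro countable_PiE countable_alphabet) simp
  qed
  \<comment> \<open>This is applied twice: with the sets \<open>?S a\<close> for the joint event,
    and with \<open>UNIV\<close> for the event on the underlying process alone.\<close>
  have decompose: "ennreal (\<P>(\<omega> in M. \<exists>a\<in>?H. ?X a \<omega> \<and> ?K \<omega> \<in> S a)) =
      (\<integral>\<^sup>+a. \<P>(\<omega> in M. ?X a \<omega> \<and> ?K \<omega> \<in> S a) \<partial>count_space ?H)" for S
  proof (rule prob_EX_countable[OF event countable], intro AE_I2 ballI impI)
    fix \<omega> a a' assume "a \<in> ?H" "a' \<in> ?H" "?X a \<omega> \<and> ?K \<omega> \<in> S a" "?X a' \<omega> \<and> ?K \<omega> \<in> S a'"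
    then show "a = a'"
      by (intro PiE_ext[of a "{1..Suc n}" "\<lambda>_. A" a']) auto
  qed
  have history: "(\<exists>a\<in>?H. ?X a \<omega> \<and> T a) \<longleftrightarrow>
      card {i \<in> {1..n}. underlying Z i \<omega> = underlying Z (Suc n) \<omega>} = m \<and>
      T (restrict (\<lambda>i. underlying Z i \<omega>) {1..Suc n})" if "\<omega> \<in> space M" for \<omega> T
  proof -
    let ?a = "restrict (\<lambda>i. underlying Z i \<omega>) {1..Suc n}"
    have a: "?a \<in> ?A"
      using value_in[OF _ that] by (intro restrict_PiE_iff[THEN iffD2] ballI) (simp add: underlying_def mem_Times_iff)
    have I: "?I ?a = {i \<in> {1..n}. underlying Z i \<omega> = underlying Z (Suc n) \<omega>}"
      by auto
    have "a = ?a" if "a \<in> ?A" "?X a \<omega>" for a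
      by (rule PiE_ext[OF that(1) a]) (use that(2) in simp)
    moreover have "?X ?a \<omega>"
      by simp
    ultimately show ?thesis
      unfolding I[symmetric] using a by blast
  qed
  have L: "repeats (underlying Z) n \<omega> = m \<longleftrightarrow> (\<exists>a\<in>?H. ?X a \<omega> \<and> ?K \<omega> \<in> UNIV)" if "\<omega> \<in> space M" for \<omega>
    using history[OF that, of "\<lambda>_. True"] by (simp add: repeats_eq_card)
  have "{i \<in> {1..n}. Z i \<omega> = Z (Suc n) \<omega>} =
      {i \<in> ?I (restrict (\<lambda>i. underlying Z i \<omega>) {1..Suc n}). ?K \<omega> i = ?K \<omega> (Suc n)}" for \<omega>
    by (auto simp: underlying_def prod_eq_iff)
  then have LL: "repeats Z n \<omega> = r \<and> repeats (underlying Z) n \<omega> = m \<longleftrightarrow> (\<exists>a\<in>?H. ?X a \<omega> \<and> ?K \<omega> \<in> ?S a)"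
    if "\<omega> \<in> space M" for \<omega>
    unfolding repeats_eq_card history[OF that] by auto
  have le: "ennreal (\<P>(\<omega> in M. ?X a \<omega> \<and> ?K \<omega> \<in> ?S a)) \<le> ennreal B * ennreal (\<P>(\<omega> in M. ?X a \<omega> \<and> ?K \<omega> \<in> UNIV))"
    if "a \<in> ?H" for a
  proof -
    have a: "a i \<in> A" if "i \<in> {1..Suc n}" for i
      using \<open>a \<in> ?H\<close> that by (auto dest: PiE_mem)
    \<comment> \<open>All indices in \<open>?I a\<close> carry the letter \<open>a (Suc n)\<close>,
      hence the same law, and there are \<open>m\<close> of them.\<close>
    have "emeasure (Pi_pmf {1..Suc n} 0 (\<lambda>i. P (a i))) (?S a) \<le> ennreal B"
      using B[OF a[of "Suc n"]] \<open>a \<in> ?H\<close> by (subst emeasure_Pi_pmf_matches) auto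
    moreover have "ennreal (\<P>(\<omega> in M. ?X a \<omega> \<and> ?K \<omega> \<in> ?S a)) =
        ?w a * emeasure (Pi_pmf {1..Suc n} 0 (\<lambda>i. P (a i))) (?S a)"
      by (rule conditional_regimes[OF a])
    moreover have "ennreal (\<P>(\<omega> in M. ?X a \<omega> \<and> ?K \<omega> \<in> UNIV)) =
        ?w a * emeasure (Pi_pmf {1..Suc n} 0 (\<lambda>i. P (a i))) UNIV"
      by (rule conditional_regimes[OF a])
    ultimately show ?thesis
      by (simp only: emeasure_pmf_UNIV mult_1_right mult.commute[of "ennreal B"] mult_left_mono zero_le)
  qed
  have "ennreal (\<P>(\<omega> in M. repeats Z n \<omega> = r \<and> repeats (underlying Z) n \<omega> = m)) =
      ennreal (\<P>(\<omega> in M. \<exists>a\<in>?H. ?X a \<omega> \<and> ?K \<omega> \<in> ?S a))"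
    using LL by (intro arg_cong[of _ _ ennreal] arg_cong[of _ _ prob]) blast
  also have "\<dots> \<le> (\<integral>\<^sup>+a. ennreal B * ennreal (\<P>(\<omega> in M. ?X a \<omega> \<and> ?K \<omega> \<in> UNIV)) \<partial>count_space ?H)"
    unfolding decompose by (rule nn_integral_mono) (use le in simp)
  also have "\<dots> = ennreal B * ennreal (\<P>(\<omega> in M. \<exists>a\<in>?H. ?X a \<omega> \<and> ?K \<omega> \<in> UNIV))"
    unfolding decompose by (rule nn_integral_cmult) simp
  also have "\<dots> = ennreal (B * \<P>(\<omega> in M. repeats (underlying Z) n \<omega> = m))"
    unfolding ennreal_mult'[OF \<open>0 \<le> B\<close>]
    using L by (intro arg_cong[of _ _ "\<lambda>x. ennreal B * ennreal (prob x)"]) blast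
  finally show ?thesis
    using \<open>0 \<le> B\<close> by (simp add: ennreal_le_iff)
qed

section \<open>Decomposition over the number of underlying repetitions\<close>

lemma underlying_repeats_event: "{\<omega>\<in>space M. Q (repeats (underlying Z) n \<omega>)} \<in> events"
  by (rule repeats_event[of "\<lambda>_. Q"])

text \<open>Equal pairs have equal first coordinates, so on the event in question the underlying
  number of repetitions lies between \<open>r\<close> and \<open>n\<close>.\<close>

lemma prob_repeats_eq_sum:
  "\<P>(\<omega> in M. repeats Z n \<omega> = r) =
    (\<Sum>m\<in>{r..n}. \<P>(\<omega> in M. repeats Z n \<omega> = r \<and> repeats (underlying Z) n \<omega> = m))"
proof -
  have "{\<omega>\<in>space M. repeats Z n \<omega> = r} =
      (\<Union>m\<in>{r..n}. {\<omega>\<in>space M. repeats Z n \<omega> = r \<and> repeats (underlying Z) n \<omega> = m})"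
    using repeats_le repeats_le_repeats_underlying by auto
  then show ?thesis
    using repeats_event
    by (simp only:) (rule finite_measure_finite_Union, auto simp: disjoint_family_on_def)
qed

lemma expectation_underlying_repeats:
  fixes g :: "nat \<Rightarrow> real"
  shows "expectation (\<lambda>\<omega>. of_bool (repeats (underlying Z) n \<omega> > r) * g (repeats (underlying Z) n \<omega>)) =
    (\<Sum>m\<in>{r<..n}. g m * \<P>(\<omega> in M. repeats (underlying Z) n \<omega> = m))"
proof -
  let ?E = "\<lambda>m. {\<omega>\<in>space M. repeats (underlying Z) n \<omega> = m}"
  have E: "?E m \<in> events" for m
    by (rule underlying_repeats_event)
  have "expectation (\<lambda>\<omega>. of_bool (repeats (underlying Z) n \<omega> > r) * g (repeats (underlying Z) n \<omega>)) =
      expectation (\<lambda>\<omega>. \<Sum>m\<in>{r<..n}. g m * indicator (?E m) \<omega>)"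
  proof (rule Bochner_Integration.integral_cong[OF refl])
    fix \<omega> assume \<omega>: "\<omega> \<in> space M"
    have "(\<Sum>m\<in>{r<..n}. g m * indicator (?E m) \<omega>) =
        (\<Sum>m\<in>{r<..n}. if repeats (underlying Z) n \<omega> = m then g m else 0)"
      using \<omega> by (intro sum.cong) auto
    then show "of_bool (repeats (underlying Z) n \<omega> > r) * g (repeats (underlying Z) n \<omega>) =
        (\<Sum>m\<in>{r<..n}. g m * indicator (?E m) \<omega>)"
      using repeats_le[of "underlying Z" n \<omega>] by simp
  qed
  also have "\<dots> = (\<Sum>m\<in>{r<..n}. g m * prob (?E m))"
  proof (subst Bochner_Integration.integral_sum)
    show "integrable M (\<lambda>\<omega>. g m * indicator (?E m) \<omega>)" for m
      using E by (intro integrable_mult_right integrable_real_indicator) (auto simp: emeasure_eq_measure)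
    show "(\<Sum>m\<in>{r<..n}. \<integral>\<omega>. g m * indicator (?E m) \<omega> \<partial>M) = (\<Sum>m\<in>{r<..n}. g m * prob (?E m))"
      using E by (intro sum.cong refl) simp
  qed
  finally show ?thesis .
qed

end

subsection \<open>Bounds on binomial mixtures\<close>

lemma binomial_head_bound:
  fixes p :: real
  assumes "0 \<le> p" "p \<le> 1" "r < m"
  shows "p * ((m choose r) * p ^ r * (1 - p) ^ (m - r)) \<le> c_const r / m"
proof (cases "r = 0")
  case True
  have "(1 - p) ^ m \<le> exp (- p) ^ m"
    using assms exp_ge_add_one_self[of "- p"] by (intro power_mono) auto
  also have "\<dots> = exp (- (p * m))"
    by (simp add: exp_of_nat2_mult[symmetric])
  finally have "p * m * (1 - p) ^ m \<le> p * m * exp (- (p * m))"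
    using assms by (intro mult_left_mono) auto
  \<comment> \<open>The constant \<open>exp (- 1)\<close> is the maximum of
    \<open>x * exp (- x)\<close>; the bound is \<open>1 + t \<le> exp t\<close> at
    \<open>t = p * m - 1\<close>.\<close>
  also have "\<dots> \<le> exp (p * m - 1) * exp (- (p * m))"
    using exp_ge_add_one_self[of "p * m - 1"] by (intro mult_right_mono) auto
  also have "\<dots> = exp (- 1)"
    by (simp flip: exp_add)
  finally show ?thesis
    using True assms by (simp add: c_const_def field_simps)
next
  case False
  \<comment> \<open>\<open>?b\<close> is \<open>(r + 1)/(m + 1)\<close> times the binomial probability of \<open>r + 1\<close> successes among \<open>m + 1\<close>.\<close>
  let ?b = "p * ((m choose r) * p ^ r * (1 - p) ^ (m - r))"
  have b0: "0 \<le> ?b"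
    using assms by simp
  have "pmf (binomial_pmf (Suc m) p) (Suc r) \<le> 1"
    by (rule pmf_le_1)
  then have "real (Suc m choose Suc r) * (p ^ Suc r * (1 - p) ^ (m - r)) \<le> 1"
    using assms by (simp add: mult_ac)
  then have "real (Suc r) * real (Suc m choose Suc r) * (p ^ Suc r * (1 - p) ^ (m - r)) \<le> real (Suc r)"
    using mult_left_mono[of _ 1 "real (Suc r)"] by (simp add: mult.assoc)
  moreover have "real (Suc r) * real (Suc m choose Suc r) = real (Suc m) * real (m choose r)"
    using Suc_times_binomial_eq[of m r] by (metis mult.commute of_nat_mult)
  moreover have "real (Suc m) * ?b = real (Suc m) * real (m choose r) * (p ^ Suc r * (1 - p) ^ (m - r))"
    by (simp only: power_Suc mult_ac)
  ultimately have "real (Suc m) * ?b \<le> real (Suc r)"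
    by (simp only:)
  then have "real m * ?b \<le> real (Suc r)"
    using b0 by (simp add: algebra_simps)
  \<comment> \<open>The argument gives the constant \<open>r + 1\<close>, which
    \<open>c_const r\<close> dominates because \<open>sqrt pi \<le> 2 \<le> exp 1\<close>.\<close>
  also have "real (Suc r) \<le> c_const r"
  proof -
    have "sqrt pi \<le> 2"
      using pi_less_4 by (intro real_le_lsqrt) auto
    also have "2 \<le> exp (1::real)"
      using exp_ge_add_one_self[of 1] by simp
    finally have "real (Suc r) * sqrt pi \<le> real (Suc r) * exp 1"
      by (intro mult_left_mono) auto
    then show ?thesis
      using False by (simp add: c_const_def pos_le_divide_eq mult.commute)
  qed
  finally show ?thesis
    using assms by (simp add: field_simps)
qed

text \<open>At most \<open>1 / \<epsilon>\<close> atoms can have mass at least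
  \<open>\<epsilon>\<close>. The finiteness ensures that \<open>card\<close> counts these atoms and
  is not the default value 0.\<close>

lemma finite_pmf_ge: "0 < \<epsilon> \<Longrightarrow> finite {k. \<epsilon> \<le> pmf q k}"
proof -
  assume "0 < \<epsilon>"
  have "card F \<le> nat \<lfloor>1 / \<epsilon>\<rfloor>" if "F \<subseteq> {k. \<epsilon> \<le> pmf q k}" "finite F" for F
  proof -
    have "card F * \<epsilon> \<le> (\<Sum>k\<in>F. pmf q k)"
      using that by (intro sum_bounded_below) auto
    also have "\<dots> = measure q F"
      using that by (simp add: measure_measure_pmf_finite)
    also have "\<dots> \<le> 1"
      by simp
    finally show ?thesis
      using \<open>0 < \<epsilon>\<close> by (simp add: field_simps le_nat_floor)
  qed
  then show ?thesis
    by (meson finite_if_finite_subsets_card_bdd)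
qed

section \<open>Power integrals and the incomplete gamma function\<close>

lemma nn_integral_powr_from_0:
  assumes "0 < s" "0 \<le> c"
  shows "(\<integral>\<^sup>+x\<in>{0<..c}. ennreal (x powr (s - 1)) \<partial>lborel) = ennreal (c powr s / s)"
proof -
  have "((\<lambda>x. x powr (s - 1)) has_integral c powr (s - 1 + 1) / (s - 1 + 1)) {0..c}"
    by (rule has_integral_powr_from_0) (use assms in auto)
  then have "((\<lambda>x. if x \<in> {0..c} then x powr (s - 1) else 0) has_integral c powr s / s) UNIV"
    by (simp add: has_integral_restrict_UNIV del: atLeastAtMost_iff)
  then have "(\<integral>\<^sup>+x. ennreal (if x \<in> {0..c} then x powr (s - 1) else 0) \<partial>lborel) = ennreal (c powr s / s)"
    by (intro nn_integral_has_integral_lborel) auto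
  also have "(\<lambda>x. ennreal (if x \<in> {0..c} then x powr (s - 1) else 0)) =
      (\<lambda>x. ennreal (x powr (s - 1)) * indicator {0<..c} x)"
    by (auto simp: fun_eq_iff indicator_def)
  finally show ?thesis .
qed

text \<open>On \<open>{0<..1/2}\<close> one has \<open>exp (- u) \<ge> exp (- (1 / 2))\<close>, and
  lowering the exponent from \<open>s - 1\<close> to \<open>t - 1\<close> increases the power. The
  case \<open>t = s\<close> serves to estimate \<open>c1\<close>; \<open>t = 0\<close> with small
  \<open>s\<close> yields divergence.\<close>

lemma inc_gamma_lower_bound:
  assumes "0 < s" "t \<le> s"
  shows "ereal (exp (- (1 / 2)) * ((1 / 2) powr s / s)) \<le> inc_gamma t (1 / 2)"
proof -
  have "ennreal (exp (- (1 / 2)) * ((1 / 2) powr s / s)) =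
      ennreal (exp (- (1 / 2))) * (\<integral>\<^sup>+u\<in>{0<..1/2}. ennreal (u powr (s - 1)) \<partial>lborel)"
    using assms by (subst nn_integral_powr_from_0) (simp_all add: ennreal_mult''[symmetric])
  also have "\<dots> = (\<integral>\<^sup>+u. ennreal (exp (- (1 / 2))) * (ennreal (u powr (s - 1)) * indicator {0<..1/2} u) \<partial>lborel)"
    by (rule nn_integral_cmult[symmetric]) measurable
  also have "\<dots> \<le> (\<integral>\<^sup>+u\<in>{0<..1/2}. ennreal (u powr (t - 1) * exp (- u)) \<partial>lborel)"
  proof (rule nn_integral_mono)
    fix u :: real
    have "exp (- (1 / 2)) * u powr (s - 1) \<le> u powr (t - 1) * exp (- u)" if "0 < u" "u \<le> 1 / 2"
    proof -
      have "u powr (s - 1) \<le> u powr (t - 1)"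
        using that assms by (intro powr_mono') auto
      then show ?thesis
        using that mult_mono[of "u powr (s - 1)" "u powr (t - 1)" "exp (- (1 / 2))" "exp (- u)"]
        by (simp add: mult.commute)
    qed
    then show "ennreal (exp (- (1 / 2))) * (ennreal (u powr (s - 1)) * indicator {0<..1/2} u) \<le>
        ennreal (u powr (t - 1) * exp (- u)) * indicator {0<..1/2} u"
      by (auto simp: indicator_def ennreal_mult[symmetric] intro!: ennreal_leI)
  qed
  finally have "enn2ereal (ennreal (exp (- (1 / 2)) * ((1 / 2) powr s / s))) \<le> inc_gamma t (1 / 2)"
    unfolding inc_gamma_def less_eq_ennreal.rep_eq .
  moreover have "0 \<le> exp (- (1 / 2)) * ((1 / 2) powr s / s)"
    using assms by simp
  ultimately show ?thesis
    by (simp only: enn2ereal_ennreal)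
qed

lemma inc_gamma_0: "inc_gamma 0 (1 / 2) = \<infinity>"
proof (rule ereal_top)
  fix B :: real
  \<comment> \<open>Chosen so that \<open>exp (- (1 / 2)) * ((1 / 2) / s)\<close> equals
    \<open>\<bar>B\<bar> + 1\<close>.\<close>
  define s :: real where "s = exp (- (1 / 2)) / (2 * (\<bar>B\<bar> + 1))"
  have pos: "0 < 2 * (\<bar>B\<bar> + 1)"
    using abs_ge_zero[of B] by (intro mult_pos_pos) auto
  have "exp (- (1 / 2)) \<le> (1 :: real)"
    by simp
  also have "1 \<le> 2 * (\<bar>B\<bar> + 1)"
    using abs_ge_zero[of B] by (simp add: distrib_left)
  finally have s: "0 < s" "s \<le> 1"
    unfolding s_def using pos by (simp_all only: divide_le_eq_1_pos divide_pos_pos exp_gt_zero)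
  have "B \<le> \<bar>B\<bar> + 1"
    by simp
  also have "\<dots> = exp (- (1 / 2)) * ((1 / 2) powr 1 / s)"
    unfolding s_def by (simp add: field_simps)
  also have "\<dots> \<le> exp (- (1 / 2)) * ((1 / 2) powr s / s)"
    using s by (intro mult_left_mono divide_right_mono powr_mono') auto
  finally show "ereal B \<le> inc_gamma 0 (1 / 2)"
    using order_trans[OF _ inc_gamma_lower_bound[of s 0]] s by simp
qed

section \<open>Mixture bounds from bounds on the number of large atoms\<close>

text \<open>Only atoms below \<open>\<delta>\<close> enter, so counts at levels up to
  \<open>\<delta>\<close> suffice, and there a single constant \<open>C\<close> can replace the
  slowly varying factor. The integrand becomes \<open>C * (1 + r) * x powr (r - \<alpha>)\<close>,
  integrable at 0 by the first hypothesis.\<close>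

lemma pmf_power_tail_bound:
  fixes q :: "nat pmf"
  assumes s: "0 < 1 + real r - \<alpha>" and "0 < \<delta>" "0 \<le> C"
    and count: "\<And>\<epsilon>. 0 < \<epsilon> \<Longrightarrow> \<epsilon> \<le> \<delta> \<Longrightarrow> card {k. \<epsilon> \<le> pmf q k} \<le> C * \<epsilon> powr (- \<alpha>)"
  shows "(\<integral>\<^sup>+y. ennreal (of_bool (pmf q y < \<delta>) * pmf q y ^ Suc r) \<partial>count_space UNIV) \<le>
    ennreal (C * (1 + real r) * (\<delta> powr (1 + real r - \<alpha>) / (1 + real r - \<alpha>)))"
proof -
  let ?s = "1 + real r - \<alpha>"
  \<comment> \<open>Layer cake: \<open>p\<^sup>r\<^sup>+\<^sup>1\<close> is the integral of \<open>(r + 1) x\<^sup>r\<close> over \<open>x \<le> p\<close>; sum and integral are exchanged.\<close>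
  let ?g = "\<lambda>y x. ennreal (of_bool (pmf q y < \<delta>) * ((1 + real r) * x ^ r)) * indicator {0..pmf q y} x"
  have g: "ennreal (of_bool (pmf q y < \<delta>) * pmf q y ^ Suc r) = (\<integral>\<^sup>+x. ?g y x \<partial>lborel)" for y
  proof -
    have "(\<integral>\<^sup>+x. ?g y x \<partial>lborel) =
        ennreal (of_bool (pmf q y < \<delta>) * pmf q y ^ Suc r - of_bool (pmf q y < \<delta>) * 0 ^ Suc r)"
    proof (rule nn_integral_FTC_Icc)
      show "((\<lambda>x. of_bool (pmf q y < \<delta>) * x ^ Suc r) has_real_derivative
          of_bool (pmf q y < \<delta>) * ((1 + real r) * x ^ r)) (at x)" for x
        using DERIV_cmult[OF DERIV_pow[of "Suc r" x]] by simp
    qed auto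
    then show ?thesis
      by simp
  qed
  have "(\<integral>\<^sup>+y. ennreal (of_bool (pmf q y < \<delta>) * pmf q y ^ Suc r) \<partial>count_space UNIV) =
      (\<integral>\<^sup>+x. (\<Sum>y. ?g y x) \<partial>lborel)"
    unfolding g nn_integral_count_space_nat by (rule nn_integral_suminf[symmetric]) measurable
  also have "\<dots> \<le> (\<integral>\<^sup>+x. ennreal (C * (1 + real r)) * (ennreal (x powr (?s - 1)) * indicator {0<..\<delta>} x) \<partial>lborel)"
  \<comment> \<open>At \<open>x = 0\<close> the right side vanishes, while for \<open>r = 0\<close>
    the left side is infinite; this null point is removed.\<close>
  proof (rule nn_integral_mono_AE, rule AE_mp[OF AE_lborel_singleton[of 0]], rule AE_I2, rule impI)
    fix x :: real assume "x \<noteq> 0"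
    show "(\<Sum>y. ?g y x) \<le> ennreal (C * (1 + real r)) * (ennreal (x powr (?s - 1)) * indicator {0<..\<delta>} x)"
    proof (cases "0 < x \<and> x \<le> \<delta>")
      case False
      then have "?g y x = 0" for y
        using \<open>x \<noteq> 0\<close> by (auto simp: indicator_def)
      then have "(\<Sum>y. ?g y x) = 0"
        by (simp only: suminf_zero)
      then show ?thesis
        by (simp only: zero_le)
    next
      case True
      have "(\<Sum>y. ?g y x) \<le> (\<Sum>y. ennreal ((1 + real r) * x ^ r) * indicator {y. x \<le> pmf q y} y)"
      proof (rule suminf_le[OF _ summableI summableI])
        show "?g y x \<le> ennreal ((1 + real r) * x ^ r) * indicator {y. x \<le> pmf q y} y" for y
          by (cases "pmf q y < \<delta>") (auto simp: indicator_def)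
      qed
      also have "\<dots> = ennreal ((1 + real r) * x ^ r) * emeasure (count_space UNIV) {y. x \<le> pmf q y}"
        by (subst nn_integral_count_space_nat[symmetric]) (simp add: nn_integral_cmult_indicator)
      also have "\<dots> = ennreal ((1 + real r) * x ^ r * card {y. x \<le> pmf q y})"
        using True finite_pmf_ge[of x q]
        by (simp add: emeasure_count_space_finite ennreal_of_nat_eq_real_of_nat ennreal_mult')
      also have "\<dots> \<le> ennreal ((1 + real r) * x ^ r * (C * x powr (- \<alpha>)))"
        using True count[of x] by (intro ennreal_leI mult_left_mono) auto
      also have "(1 + real r) * x ^ r * (C * x powr (- \<alpha>)) = C * (1 + real r) * x powr (?s - 1)"
      proof -
        have "x powr (?s - 1) = x powr real r * x powr (- \<alpha>)"
          by (simp flip: powr_add)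
        then show ?thesis
          using True by (simp add: powr_realpow mult_ac)
      qed
      finally show ?thesis
        using True \<open>0 \<le> C\<close> by (simp add: ennreal_mult indicator_def)
    qed
  qed
  also have "\<dots> = ennreal (C * (1 + real r)) * (\<integral>\<^sup>+x\<in>{0<..\<delta>}. ennreal (x powr (?s - 1)) \<partial>lborel)"
    by (rule nn_integral_cmult) measurable
  also have "\<dots> = ennreal (C * (1 + real r) * (\<delta> powr ?s / ?s))"
    using assms by (subst nn_integral_powr_from_0) (auto simp: ennreal_mult[symmetric] simp del: ennreal_plus)
  finally show ?thesis .
qed

text \<open>At the threshold \<open>1 / m\<close> both parts have the same order: the large atoms
  give \<open>m powr \<alpha> / m\<close>, the small ones
  \<open>m ^ r * m powr (- (1 + r - \<alpha>))\<close>, and each equals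
  \<open>m powr (- (1 - \<alpha>))\<close>. \<open>\<Lambda>\<close> stands for
  \<open>l m\<close>.\<close>

lemma binomial_mixture_bound:
  fixes q :: "nat pmf"
  assumes s: "0 < 1 + real r - \<alpha>" and "r < m" and "0 \<le> \<Lambda>"
    and count: "\<And>\<epsilon>. 0 < \<epsilon> \<Longrightarrow> \<epsilon> \<le> 1 / real m \<Longrightarrow> real (card {k. \<epsilon> \<le> pmf q k}) \<le> \<Lambda> * \<epsilon> powr (- \<alpha>)"
  shows "(\<integral>\<^sup>+y. ennreal (pmf (binomial_pmf m (pmf q y)) r) \<partial>measure_pmf q) \<le>
    ennreal ((c_const r + (1 + real r) / ((1 + real r - \<alpha>) * fact r)) * (real m powr (- (1 - \<alpha>)) * \<Lambda>))"
proof -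
  let ?s = "1 + real r - \<alpha>"
  let ?T = "{y. 1 / real m \<le> pmf q y}"
  have m: "0 < real m"
    using \<open>r < m\<close> by simp
  have c: "0 \<le> c_const r"
    by (simp add: c_const_def)
  have "(\<integral>\<^sup>+y. ennreal (pmf (binomial_pmf m (pmf q y)) r) \<partial>measure_pmf q) =
      (\<integral>\<^sup>+y. ennreal (pmf q y * ((m choose r) * pmf q y ^ r * (1 - pmf q y) ^ (m - r))) \<partial>count_space UNIV)"
    by (simp add: nn_integral_measure_pmf ennreal_mult' pmf_le_1)
  also have "\<dots> \<le> (\<integral>\<^sup>+y. ennreal (c_const r / m) * indicator ?T y +
      ennreal (m ^ r / fact r) * ennreal (of_bool (pmf q y < 1 / m) * pmf q y ^ Suc r) \<partial>count_space UNIV)"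
  proof (rule nn_integral_mono)
    fix y
    show "ennreal (pmf q y * ((m choose r) * pmf q y ^ r * (1 - pmf q y) ^ (m - r))) \<le>
      ennreal (c_const r / m) * indicator ?T y +
      ennreal (m ^ r / fact r) * ennreal (of_bool (pmf q y < 1 / m) * pmf q y ^ Suc r)"
    proof (cases "y \<in> ?T")
      case True
      then show ?thesis
        using binomial_head_bound[of "pmf q y" r m] \<open>r < m\<close>
        by (auto simp: pmf_le_1 intro!: ennreal_leI)
    next
      \<comment> \<open>For a small atom, \<open>m choose r\<close> is at most
        \<open>m ^ r / fact r\<close> and the failure factor at most 1, leaving the power
        \<open>Suc r\<close> of the mass.\<close>
      case False
      have "real ((m choose r) * fact r) \<le> real (m ^ r)"
        unfolding of_nat_le_iff by (rule binomial_fact_pow)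
      then have "real (m choose r) \<le> m ^ r / fact r"
        by (simp add: pos_le_divide_eq)
      moreover have "(1 - pmf q y) ^ (m - r) \<le> 1"
        by (simp add: power_le_one pmf_le_1)
      ultimately have "(m choose r) * (1 - pmf q y) ^ (m - r) \<le> m ^ r / fact r * 1"
        by (intro mult_mono) (auto simp: pmf_le_1)
      then have "pmf q y ^ Suc r * ((m choose r) * (1 - pmf q y) ^ (m - r)) \<le> pmf q y ^ Suc r * (m ^ r / fact r)"
        by (intro mult_left_mono) auto
      then show ?thesis
        using False by (auto simp: ennreal_mult'[symmetric] mult_ac intro!: ennreal_leI)
    qed
  qed
  also have "\<dots> = ennreal (c_const r / m) * emeasure (count_space UNIV) ?T +
      ennreal (m ^ r / fact r) *
      (\<integral>\<^sup>+y. ennreal (of_bool (pmf q y < 1 / m) * pmf q y ^ Suc r) \<partial>count_space UNIV)"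
    by (simp add: nn_integral_add nn_integral_cmult nn_integral_cmult_indicator)
  also have "\<dots> \<le> ennreal (c_const r / m) * ennreal (\<Lambda> * (1 / m) powr (- \<alpha>)) +
      ennreal (m ^ r / fact r) * ennreal (\<Lambda> * (1 + real r) * ((1 / m) powr ?s / ?s))"
  proof (intro add_mono mult_left_mono)
    show "emeasure (count_space UNIV) ?T \<le> ennreal (\<Lambda> * (1 / m) powr (- \<alpha>))"
      using count[of "1 / m"] m finite_pmf_ge[of "1 / m" q]
      by (simp add: emeasure_count_space_finite ennreal_of_nat_eq_real_of_nat ennreal_leI)
    show "(\<integral>\<^sup>+y. ennreal (of_bool (pmf q y < 1 / m) * pmf q y ^ Suc r) \<partial>count_space UNIV) \<le>
        ennreal (\<Lambda> * (1 + real r) * ((1 / m) powr ?s / ?s))"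
      by (rule pmf_power_tail_bound) (use assms m in auto)
  qed auto
  also have "\<dots> = ennreal (c_const r / m * (\<Lambda> * (1 / m) powr (- \<alpha>)) +
      m ^ r / fact r * (\<Lambda> * (1 + real r) * ((1 / m) powr ?s / ?s)))"
    using assms m c by (simp add: ennreal_mult'[symmetric] ennreal_plus[symmetric] del: ennreal_plus)
  also have "c_const r / m * (\<Lambda> * (1 / m) powr (- \<alpha>)) + m ^ r / fact r * (\<Lambda> * (1 + real r) * ((1 / m) powr ?s / ?s)) =
      (c_const r + (1 + real r) / (?s * fact r)) * (real m powr (- (1 - \<alpha>)) * \<Lambda>)"
  proof -
    have inv: "(1 / m) powr t = real m powr (- t)" for t
      using m by (simp add: powr_minus_divide powr_divide)
    have "real m powr (- (1 - \<alpha>)) = real m powr \<alpha> / real m"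
      using powr_diff[of "real m" \<alpha> 1] m by simp
    then have "(1 / m) powr (- \<alpha>) / m = real m powr (- (1 - \<alpha>))"
      unfolding inv by simp
    moreover have "m ^ r * (1 / m) powr ?s = real m powr (- (1 - \<alpha>))"
      unfolding inv using m powr_add[of "real m" "real r" "- ?s"] by (simp add: powr_realpow)
    moreover have "c_const r / m * (\<Lambda> * (1 / m) powr (- \<alpha>)) = c_const r * ((1 / m) powr (- \<alpha>) / m * \<Lambda>)"
      by simp
    moreover have "m ^ r / fact r * (\<Lambda> * (1 + real r) * ((1 / m) powr ?s / ?s)) =
        (1 + real r) / (?s * fact r) * (m ^ r * (1 / m) powr ?s * \<Lambda>)"
      by (simp only: times_divide_eq_left times_divide_eq_right divide_divide_eq_left mult_ac)
    ultimately show ?thesis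
      by (simp only: distrib_right)
  qed
  finally show ?thesis .
qed

text \<open>When all \<open>r\<close> letters have to match, an atom of mass at least
  \<open>1 / r\<close> contributes at most \<open>b ^ (r + 1)\<close>. For a smaller atom the power
  \<open>r\<close> of its mass is at most \<open>r powr (- r)\<close>, and the remaining factor sums
  to 1 over all atoms.\<close>

lemma full_match_bound:
  fixes q :: "nat pmf"
  assumes "1 \<le> r" and b: "\<And>k. pmf q k \<le> b"
    and count: "real (card {k. 1 / real r \<le> pmf q k}) \<le> C"
  shows "(\<integral>\<^sup>+y. ennreal (pmf (binomial_pmf r (pmf q y)) r) \<partial>measure_pmf q) \<le>
    ennreal (b ^ (r + 1) * C + real r powr (- real r))"
proof -
  let ?T = "{k. 1 / real r \<le> pmf q k}"
  have b0: "0 \<le> b"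
    using b[of undefined] pmf_nonneg[of q undefined] by linarith
  have r: "real r powr (- real r) = (1 / real r) ^ r"
    using \<open>1 \<le> r\<close> by (simp add: powr_minus powr_realpow power_divide field_simps)
  have C0: "0 \<le> C"
    using count by (rule order_trans[OF of_nat_0_le_iff])
  have "(\<integral>\<^sup>+y. ennreal (pmf (binomial_pmf r (pmf q y)) r) \<partial>measure_pmf q) =
      (\<integral>\<^sup>+y. ennreal (pmf q y) * ennreal (pmf q y ^ r) \<partial>count_space UNIV)"
    by (simp add: nn_integral_measure_pmf pmf_le_1)
  also have "\<dots> \<le> (\<integral>\<^sup>+y. ennreal (b ^ (r + 1)) * indicator ?T y +
      ennreal (real r powr (- real r)) * ennreal (pmf q y) \<partial>count_space UNIV)"
  proof (rule nn_integral_mono)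
    fix y
    show "ennreal (pmf q y) * ennreal (pmf q y ^ r) \<le>
      ennreal (b ^ (r + 1)) * indicator ?T y + ennreal (real r powr (- real r)) * ennreal (pmf q y)"
    proof (cases "y \<in> ?T")
      case True
      have "pmf q y ^ (r + 1) \<le> b ^ (r + 1)"
        using b by (intro power_mono) auto
      then have "ennreal (pmf q y) * ennreal (pmf q y ^ r) \<le> ennreal (b ^ (r + 1)) * indicator ?T y"
        using True by (simp add: ennreal_mult'[symmetric] ennreal_leI)
      then show ?thesis
        by (rule order_trans) simp
    next
      case False
      then have "pmf q y ^ r \<le> real r powr (- real r)"
        unfolding r by (intro power_mono) auto
      then have "ennreal (pmf q y) * ennreal (pmf q y ^ r) \<le> ennreal (real r powr (- real r)) * ennreal (pmf q y)"
        by (subst mult.commute) (intro mult_right_mono ennreal_leI, auto)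
      then show ?thesis
        by (rule order_trans) simp
    qed
  qed
  also have "\<dots> = ennreal (b ^ (r + 1)) * emeasure (count_space UNIV) ?T + ennreal (real r powr (- real r))"
    by (simp add: nn_integral_add nn_integral_cmult nn_integral_cmult_indicator nn_integral_pmf)
  also have "\<dots> \<le> ennreal (b ^ (r + 1)) * ennreal C + ennreal (real r powr (- real r))"
    using count finite_pmf_ge[of "1 / real r" q] \<open>1 \<le> r\<close>
    by (intro add_mono mult_left_mono)
      (simp_all add: emeasure_count_space_finite ennreal_of_nat_eq_real_of_nat ennreal_leI)
  also have "\<dots> = ennreal (b ^ (r + 1) * C + real r powr (- real r))"
    using b0 C0 by (subst ennreal_plus) (simp_all add: ennreal_mult)
  finally show ?thesis .
qed

lemma mixture_le_1: "(\<integral>\<^sup>+y. ennreal (pmf (binomial_pmf m (pmf q y)) r) \<partial>measure_pmf q) \<le> 1"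
proof -
  have "(\<integral>\<^sup>+y. ennreal (pmf (binomial_pmf m (pmf q y)) r) \<partial>measure_pmf q) \<le> (\<integral>\<^sup>+y. 1 \<partial>measure_pmf q)"
    by (rule nn_integral_mono) (simp only: ennreal_le_1 pmf_le_1)
  then show ?thesis
    by simp
qed

text \<open>The integer 0 has mass 0 and is excluded by \<open>0 < \<epsilon>\<close>, so counting
  over all of \<open>nat\<close> adds nothing.\<close>

lemma counting_function_eq_card:
  assumes "set_pmf (P a) \<subseteq> {1..}" "0 < \<epsilon>"
  shows "counting_function P a \<epsilon> = card {k. \<epsilon> \<le> pmf (P a) k}"
proof -
  let ?T = "{k. \<epsilon> \<le> pmf (P a) k}"
  have T: "?T \<subseteq> {1..}"
    using assms by (force simp: set_pmf_iff)
  have "counting_function P a \<epsilon> = (\<Sum>\<^sub>\<infinity>k\<in>?T. 1)"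
    unfolding counting_function_def using T by (intro infsum_cong_neutral) auto
  then show ?thesis
    using finite_pmf_ge[OF assms(2)] by simp
qed

text \<open>Inserting the lower bound for \<open>inc_gamma\<close> and cancelling
  \<open>(1 + r - \<alpha>) * fact r\<close> leaves an elementary inequality, which follows from
  \<open>r + 1 \<le> 2 ^ r\<close>.\<close>

lemma c1_lower_bound:
  assumes "0 \<le> \<alpha>" "\<alpha> \<le> 1" "0 < 1 + real r - \<alpha>"
  shows "ereal (c_const r + (1 + real r) / ((1 + real r - \<alpha>) * fact r)) \<le> c1 \<alpha> r"
proof -
  let ?s = "1 + real r - \<alpha>"
  let ?K = "4 ^ (1 + r) / fact r * (1 + real r) powr ?s"
  let ?G = "exp (- (1 / 2)) * ((1 / 2) powr ?s / ?s) :: real"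
  have "Suc r \<le> 2 ^ r"
    by (induction r) auto
  then have "real (Suc r) \<le> 2 ^ r"
    by (metis of_nat_le_iff of_nat_numeral of_nat_power)
  \<comment> \<open>Written so that the factors can be compared: \<open>1 / 2\<close> lies below
    \<open>exp (- (1 / 2))\<close>, the power of \<open>1 + r\<close> is at least 1, and
    \<open>0 \<le> \<alpha>\<close> compares the powers of \<open>1 / 2\<close>.\<close>
  also have "2 ^ r = (1 / 2) * 4 ^ (1 + r) * (1 / 2) powr (1 + real r)"
  proof -
    have "(1 / 2 :: real) powr (1 + real r) = (1 / 2) ^ (1 + r)"
      using powr_realpow[of "1 / 2" "1 + r"] by simp
    moreover have "(4 :: real) ^ (1 + r) = 2 ^ (1 + r) * 2 ^ (1 + r)"
      by (simp flip: power_mult_distrib)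
    ultimately show ?thesis
      by (simp add: power_divide)
  qed
  also have "\<dots> \<le> exp (- (1 / 2)) * (4 ^ (1 + r) * (1 + real r) powr ?s) * (1 / 2) powr ?s"
  proof (rule mult_mono)
    show "1 / 2 * (4 :: real) ^ (1 + r) \<le> exp (- (1 / 2)) * (4 ^ (1 + r) * (1 + real r) powr ?s)"
    proof -
      have "1 / 2 * 4 ^ (1 + r) \<le> exp (- (1 / 2)) * (4 :: real) ^ (1 + r)"
        using exp_ge_add_one_self[of "- (1 / 2)"] by (intro mult_right_mono) auto
      also have "\<dots> \<le> exp (- (1 / 2)) * (4 ^ (1 + r) * (1 + real r) powr ?s)"
        using assms ge_one_powr_ge_zero[of "1 + real r" ?s]
          mult_left_mono[of 1 "(1 + real r) powr ?s" "exp (- (1 / 2)) * 4 ^ (1 + r)"] by simp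
      finally show ?thesis .
    qed
    show "(1 / 2 :: real) powr (1 + real r) \<le> (1 / 2) powr ?s"
      using assms by (intro powr_mono') auto
  qed auto
  finally have "real (Suc r) \<le> exp (- (1 / 2)) * (4 ^ (1 + r) * (1 + real r) powr ?s) * (1 / 2) powr ?s" .
  then have "real (Suc r) / (?s * fact r) \<le>
      exp (- (1 / 2)) * (4 ^ (1 + r) * (1 + real r) powr ?s) * (1 / 2) powr ?s / (?s * fact r)"
    using assms by (intro divide_right_mono) auto
  also have "\<dots> = ?K * ?G"
    by (simp only: times_divide_eq_left times_divide_eq_right divide_divide_eq_left mult_ac)
  finally have "ereal ((1 + real r) / (?s * fact r)) \<le> ereal ?K * ereal ?G"
    by simp
  also have "\<dots> \<le> ereal ?K * inc_gamma ?s (1 / 2)"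
    by (intro ereal_mult_left_mono inc_gamma_lower_bound) (use assms in auto)
  finally show ?thesis
    unfolding c1_def plus_ereal.simps(1)[symmetric] by (rule add_left_mono)
qed

subsection \<open>The bound\<close>

theorem proposition4p1:
  fixes M :: "'w measure" and A :: "'a set" and P :: "'a \<Rightarrow> nat pmf"
    and R :: "'a list \<Rightarrow> 'a pmf" and Z :: "nat \<Rightarrow> 'w \<Rightarrow> 'a \<times> nat"
    and l :: "real \<Rightarrow> real" and \<alpha> :: real and n r :: nat
  assumes "regime_switching_process M A P R Z"
    and "0 \<le> \<alpha>" and "\<alpha> \<le> 1"
    and "antimono_on {0<..} l"
    and "slowly_varying l"
    and "\<And>a \<epsilon>. a \<in> A \<Longrightarrow> 0 < \<epsilon> \<Longrightarrow> \<epsilon> \<le> 1 \<Longrightarrow>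
           counting_function P a \<epsilon> \<le> \<epsilon> powr (- \<alpha>) * l (1 / \<epsilon>)"
    and "1 \<le> n"
  shows "ereal (\<P>(\<omega> in M. repeats Z n \<omega> = r)) \<le>
           c1 \<alpha> r * ereal (prob_space.expectation M (\<lambda>\<omega>.
               of_bool (repeats (underlying Z) n \<omega> > r)
               * real (repeats (underlying Z) n \<omega>) powr (- (1 - \<alpha>))
               * l (real (repeats (underlying Z) n \<omega>))))
           + ereal (c2 A P l \<alpha> r * \<P>(\<omega> in M. repeats (underlying Z) n \<omega> = r))"
proof -
  interpret regime_switching_process M A P R Z
    by fact
  define g where "g m = real m powr (- (1 - \<alpha>)) * l (real m)" for m :: nat
  define p where "p m = \<P>(\<omega> in M. repeats (underlying Z) n \<omega> = m)" for m
  let ?E = "\<Sum>m\<in>{r<..n}. g m * p m"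
  have E: "expectation (\<lambda>\<omega>. of_bool (repeats (underlying Z) n \<omega> > r)
      * real (repeats (underlying Z) n \<omega>) powr (- (1 - \<alpha>)) * l (real (repeats (underlying Z) n \<omega>))) = ?E"
    using expectation_underlying_repeats[of r n g] by (simp only: g_def p_def mult.assoc)
  \<comment> \<open>A probability space is nonempty and the process takes its letters in
    \<open>A\<close>, so \<open>A\<close> is nonempty.\<close>
  obtain a0 where a0: "a0 \<in> A"
    using not_empty value_in[of 1] by fastforce
  have anti: "l y \<le> l x" if "0 < x" "x \<le> y" for x y
    using assms(4) that by (auto simp: monotone_on_def)
  have count: "card {k. \<epsilon> \<le> pmf (P a) k} \<le> \<epsilon> powr (- \<alpha>) * l (1 / \<epsilon>)"
    if "a \<in> A" "0 < \<epsilon>" "\<epsilon> \<le> 1" for a \<epsilon>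
    using assms(6)[OF that] counting_function_eq_card[of P a, OF letter_distributions[OF that(1)] that(2)] by simp
  \<comment> \<open>Positivity of \<open>l\<close> is derived: some atom of \<open>P a0\<close> has
    mass at least \<open>\<epsilon>\<close> once \<open>\<epsilon>\<close> is small, so the count is
    at least 1 and \<open>l (1 / \<epsilon>) > 0\<close>. As \<open>x \<le> 1 / \<epsilon>\<close>,
    monotonicity carries this to \<open>x\<close>.\<close>
  have l_pos: "0 < l x" if "0 < x" for x
  proof -
    obtain k where k: "k \<in> set_pmf (P a0)"
      using set_pmf_not_empty[of "P a0"] by blast
    define \<epsilon> where "\<epsilon> = min (1 / x) (pmf (P a0) k)"
    have \<epsilon>: "0 < \<epsilon>" "\<epsilon> \<le> 1" "\<epsilon> \<le> pmf (P a0) k" "\<epsilon> \<le> 1 / x"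
      using k that by (auto simp: \<epsilon>_def pmf_positive min_le_iff_disj pmf_le_1)
    then have x_le: "x \<le> 1 / \<epsilon>"
      using that by (simp add: field_simps)
    have "card {k} \<le> card {k. \<epsilon> \<le> pmf (P a0) k}"
      using \<epsilon> finite_pmf_ge by (intro card_mono) auto
    then have "0 < \<epsilon> powr (- \<alpha>) * l (1 / \<epsilon>)"
      using count[OF a0 \<epsilon>(1,2)] by simp
    then have "0 < l (1 / \<epsilon>)"
      using \<epsilon> by (simp add: zero_less_mult_iff)
    with anti[OF that x_le] show ?thesis
      by simp
  qed
  have g_pos: "0 < g m" if "r < m" for m
    using that l_pos[of m] by (simp add: g_def)
  have p_nonneg: "0 \<le> p m" for m
    by (simp add: p_def)
  have terms_nonneg: "0 \<le> g m * p m" if "m \<in> {r<..n}" for m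
    using g_pos[of m] p_nonneg[of m] that by simp
  then have E0: "0 \<le> ?E"
    by (rule sum_nonneg)
  have c2: "\<P>(\<omega> in M. repeats Z n \<omega> = r \<and> repeats (underlying Z) n \<omega> = r) \<le> c2 A P l \<alpha> r * p r"
  proof -
    have "bdd_above ((\<lambda>(a, k). pmf (P a) k) ` (A \<times> {1..}))"
      by (rule bdd_aboveI[of _ 1]) (auto simp: pmf_le_1)
    then have sup: "pmf (P a) k \<le> p_sup A P" if "a \<in> A" "1 \<le> k" for a k
      unfolding p_sup_def using that by (intro cSUP_upper2[of _ _ "(a, k)"]) auto
    have sup0: "0 \<le> p_sup A P"
      using sup[OF a0, of 1] pmf_nonneg[of "P a0" 1] by linarith
    \<comment> \<open>The supremum ranges over \<open>k \<ge> 1\<close>, whereas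
      \<open>full_match_bound\<close> asks for all naturals; the atom at 0 has mass 0.\<close>
    have sup': "pmf (P a) k \<le> p_sup A P" if "a \<in> A" for a k
    proof (cases "1 \<le> k")
      case False
      then have "pmf (P a) k = 0"
        using letter_distributions[OF that] by (force simp: set_pmf_iff)
      then show ?thesis
        using sup0 by simp
    qed (use sup[OF that] in simp)
    show ?thesis
      unfolding p_def
    proof (rule repeats_bound)
      show "0 \<le> c2 A P l \<alpha> r"
        using sup0 l_pos[of r]
        by (cases "r = 0") (auto simp: c2_def intro!: add_nonneg_nonneg mult_nonneg_nonneg)
      fix a assume a: "a \<in> A"
      have "(\<integral>\<^sup>+y. ennreal (pmf (binomial_pmf r (pmf (P a) y)) r) \<partial>measure_pmf (P a)) \<le>
          ennreal (p_sup A P ^ (r + 1) * (real r powr \<alpha> * l (real r)) + real r powr (- real r))" if "1 \<le> r"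
      proof (rule full_match_bound[OF that sup'[OF a]])
        show "real (card {k. 1 / real r \<le> pmf (P a) k}) \<le> real r powr \<alpha> * l (real r)"
          using count[OF a, of "1 / real r"] that by (simp add: powr_minus powr_divide)
      qed
      then show "(\<integral>\<^sup>+y. ennreal (pmf (binomial_pmf r (pmf (P a) y)) r) \<partial>measure_pmf (P a)) \<le> ennreal (c2 A P l \<alpha> r)"
        using mixture_le_1[of "P a" r r] by (cases "r = 0") (simp_all add: c2_def min_def mult.assoc del: pmf_binomial)
    qed
  qed
  show ?thesis
  proof (cases "1 + real r - \<alpha> = 0")
    case False
    let ?c = "c_const r + (1 + real r) / ((1 + real r - \<alpha>) * fact r)"
    have s: "0 < 1 + real r - \<alpha>"
      using False assms(3) by simp
    have c0: "0 \<le> ?c"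
      using s by (simp add: c_const_def)
    have "\<P>(\<omega> in M. repeats Z n \<omega> = r \<and> repeats (underlying Z) n \<omega> = m) \<le> ?c * g m * p m"
      if "m \<in> {r<..n}" for m
      unfolding p_def
    proof (rule repeats_bound)
      have m: "r < m"
        using that by simp
      show "0 \<le> ?c * g m"
        using c0 g_pos[OF m] by (simp add: less_imp_le)
      fix a assume a: "a \<in> A"
      show "(\<integral>\<^sup>+y. ennreal (pmf (binomial_pmf m (pmf (P a) y)) r) \<partial>measure_pmf (P a)) \<le> ennreal (?c * g m)"
        unfolding g_def
      proof (rule binomial_mixture_bound[OF s m])
        show "0 \<le> l (real m)"
          using l_pos[of m] m by simp
        fix \<epsilon> :: real assume \<epsilon>: "0 < \<epsilon>" "\<epsilon> \<le> 1 / real m"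
        have "1 / real m \<le> 1"
          using m by simp
        then have "real (card {k. \<epsilon> \<le> pmf (P a) k}) \<le> \<epsilon> powr (- \<alpha>) * l (1 / \<epsilon>)"
          using \<epsilon> by (intro count[OF a]) auto
        also have "\<dots> \<le> \<epsilon> powr (- \<alpha>) * l (real m)"
          using \<epsilon> m by (intro mult_left_mono anti) (auto simp: field_simps)
        finally show "real (card {k. \<epsilon> \<le> pmf (P a) k}) \<le> l (real m) * \<epsilon> powr (- \<alpha>)"
          by (simp add: mult.commute)
      qed
    qed
    then have "(\<Sum>m\<in>{r<..n}. \<P>(\<omega> in M. repeats Z n \<omega> = r \<and> repeats (underlying Z) n \<omega> = m)) \<le> ?c * ?E"
      unfolding sum_distrib_left by (intro sum_mono) (simp add: mult.assoc)
    \<comment> \<open>If \<open>r > n\<close> the decomposition is an empty sum and the left side is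
      0; otherwise the term \<open>m = r\<close> is split off.\<close>
    moreover have "\<P>(\<omega> in M. repeats Z n \<omega> = r) \<le>
        \<P>(\<omega> in M. repeats Z n \<omega> = r \<and> repeats (underlying Z) n \<omega> = r) +
        (\<Sum>m\<in>{r<..n}. \<P>(\<omega> in M. repeats Z n \<omega> = r \<and> repeats (underlying Z) n \<omega> = m))"
      unfolding prob_repeats_eq_sum[of n r]
      by (cases "r \<le> n") (auto simp: sum.head)
    ultimately have "\<P>(\<omega> in M. repeats Z n \<omega> = r) \<le> ?c * ?E + c2 A P l \<alpha> r * p r"
      using c2 by linarith
    then have "ereal (\<P>(\<omega> in M. repeats Z n \<omega> = r)) \<le> ereal ?c * ereal ?E + ereal (c2 A P l \<alpha> r * p r)"
      by simp
    also have "\<dots> \<le> c1 \<alpha> r * ereal ?E + ereal (c2 A P l \<alpha> r * p r)"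
    proof (intro add_right_mono ereal_mult_right_mono c1_lower_bound)
      show "0 \<le> ereal ?E"
        using E0 by simp
    qed (use assms s in auto)
    finally show ?thesis
      unfolding E p_def .
  next
    case True
    \<comment> \<open>Here \<open>c\<^sub>1 = \<infinity>\<close>, so only the convention \<open>\<infinity> \<cdot> 0 = 0\<close> leaves something to prove.\<close>
    then have r: "r = 0" and \<alpha>: "\<alpha> = 1"
      using assms(3) by auto
    have c1: "c1 \<alpha> r = \<infinity>"
      unfolding c1_def r \<alpha> by (simp add: inc_gamma_0)
    show ?thesis
    proof (cases "?E = 0")
      \<comment> \<open>The expectation is then positive, so the right side is infinite.\<close>
      case False
      then show ?thesis
        unfolding E c1 using E0 by simp
    next
      case True
      \<comment> \<open>A vanishing sum of nonnegative terms with \<open>g m > 0\<close> forces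
        \<open>p m = 0\<close> for \<open>r < m \<le> n\<close>. Only \<open>m = r\<close> survives,
        and \<open>c2\<close> bounds that term.\<close>
      have "p m = 0" if "m \<in> {r<..n}" for m
      proof -
        have "g m * p m = 0"
          using True that sum_nonneg_eq_0_iff[of "{r<..n}" "\<lambda>m. g m * p m"] terms_nonneg by simp
        then show ?thesis
          using g_pos[of m] that by simp
      qed
      moreover have "\<P>(\<omega> in M. repeats Z n \<omega> = r \<and> repeats (underlying Z) n \<omega> = m) \<le> p m" for m
        unfolding p_def by (intro finite_measure_mono underlying_repeats_event) auto
      ultimately have "\<P>(\<omega> in M. repeats Z n \<omega> = r \<and> repeats (underlying Z) n \<omega> = m) = 0"
        if "m \<in> {r<..n}" for m
        using that by (metis measure_le_0_iff)
      then have "\<P>(\<omega> in M. repeats Z n \<omega> = r) =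
          \<P>(\<omega> in M. repeats Z n \<omega> = r \<and> repeats (underlying Z) n \<omega> = r)"
        unfolding prob_repeats_eq_sum[of n r] using r by (simp add: sum.head)
      then show ?thesis
        unfolding E True using c2 by (simp add: p_def zero_ereal_def[symmetric])
    qed
  qed
qed

end
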